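(* Let $\mathbb{F}\in\{\mathbb{R},\mathbb{C}\}$, $d\geq 2$, $H=\mathbb{F}^d$. There exists a formula $\varphi$ with $\mathrm{Sat}_{\mathrm{STD}}^d(\varphi)$ and $\neg\mathrm{Sat}_{\mathrm{PBA}}^d(\varphi)$; more precisely, one may take $\varphi=(p\wedge(q\vee r))\wedge \neg\bigl((p\wedge q)\vee(p\wedge r)\bigr)$ for distinct atoms $p,q,r$.
   Context: $L(H)$ is the set of linear subspaces and $\mathrm{Proj}(H)$ the set of orthogonal projectors of $H=\mathbb{F}^d$ (standard inner product). Formulas are built from atoms by $\varphi ::= p_i \mid \neg\varphi \mid (\varphi\wedge\psi)\mid(\varphi\vee\psi)$. STD: a standard valuation $v$ maps atoms to $L(H)$; $[\![p_i]\!]=v(p_i)$, $[\![\neg\varphi]\!]=[\![\varphi]\!]^\perp$, $[\![\varphi\wedge\psi]\!]=[\![\varphi]\!]\cap[\![\psi]\!]$, $[\![\varphi\vee\psi]\!]=[\![\varphi]\!]+[\![\psi]\!]$; $\mathrm{Sat}_{\mathrm{STD}}^d(\varphi)$ iff some $v$ gives $[\![\varphi]\!]\neq\{0\}$. PBA: for a projector valuation $v$ (atoms $\to\mathrm{Proj}(H)$), values are defined recursively and partially: $[\![p_i]\!]=v(p_i)$; $[\![\neg\theta]\!]=I-[\![\theta]\!]$ if $[\![\theta]\!]$ defined; $[\![\alpha\wedge\beta]\!]=[\![\alpha]\!][\![\beta]\!]$ and $[\![\alpha\vee\beta]\!]=[\![\alpha]\!]+[\![\beta]\!]-[\![\alpha]\!][\![\beta]\!]$,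 each defined only if $[\![\alpha]\!],[\![\beta]\!]$ are defined and commute; $\mathrm{Sat}_{\mathrm{PBA}}^d(\varphi)$ iff some $v$ makes $[\![\varphi]\!]^{\mathrm{PBA}}_v$ defined and nonzero. *)

theory Defs
  imports
    "HOL-Analysis.Analysis"
    "HOL-Library.Set_Algebras"
    "Jordan_Normal_Form.Conjugate"
begin

datatype fm = Atom nat | Neg fm | And fm fm | Or fm fm

text \<open>
  The Hilbert space is \<open>'a ^ 'n\<close> with \<open>'a\<close> either \<open>real\<close> or \<open>complex\<close>; \<open>conjugate\<close> is the
  identity on \<open>real\<close> and \<open>cnj\<close> on \<open>complex\<close>. The library's inner product on \<open>complex ^ 'n\<close>
  is only the real part of the Hermitian one, hence the following definition.
\<close>

definition hinner :: "'a::conjugatable_field ^ 'n \<Rightarrow> 'a ^ 'n \<Rightarrow> 'a" where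
  "hinner x y = (\<Sum>i\<in>UNIV. x $ i * conjugate (y $ i))"

definition ortho_compl :: "('a::conjugatable_field ^ 'n) set \<Rightarrow> ('a ^ 'n) set" where
  "ortho_compl S = {x. \<forall>y\<in>S. hinner x y = 0}"

definition ortho_projector :: "'a::conjugatable_field ^ 'n ^ 'n \<Rightarrow> bool" where
  "ortho_projector P \<longleftrightarrow>
     P ** P = P \<and> (\<forall>x y. hinner (P *v x) y = hinner x (P *v y))"

text \<open>\<open>vec.subspace\<close> is closure under scalars from \<open>'a\<close>, unlike \<open>subspace\<close> (real scalars).
  In \<open>std_val\<close>, \<open>+\<close> is the elementwise sum of sets.\<close>

primrec std_val :: "(nat \<Rightarrow> ('a::conjugatable_field ^ 'n) set) \<Rightarrow> fm \<Rightarrow> ('a ^ 'n) set" where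
  "std_val v (Atom i) = v i"
| "std_val v (Neg \<phi>) = ortho_compl (std_val v \<phi>)"
| "std_val v (And \<phi> \<psi>) = std_val v \<phi> \<inter> std_val v \<psi>"
| "std_val v (Or \<phi> \<psi>) = std_val v \<phi> + std_val v \<psi>"

definition sat_std :: "('a::conjugatable_field ^ 'n) itself \<Rightarrow> fm \<Rightarrow> bool" where
  "sat_std H \<phi> \<longleftrightarrow>
     (\<exists>v :: nat \<Rightarrow> ('a ^ 'n) set. (\<forall>i. vec.subspace (v i)) \<and> std_val v \<phi> \<noteq> {0})"

text \<open>\<open>None\<close> means that the value is undefined.\<close>

primrec pba_val ::
  "(nat \<Rightarrow> 'a::conjugatable_field ^ 'n ^ 'n) \<Rightarrow> fm \<Rightarrow> ('a ^ 'n ^ 'n) option" where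
  "pba_val v (Atom i) = Some (v i)"
| "pba_val v (Neg \<phi>) =
     (case pba_val v \<phi> of None \<Rightarrow> None | Some A \<Rightarrow> Some (mat 1 - A))"
| "pba_val v (And \<phi> \<psi>) =
     (case (pba_val v \<phi>, pba_val v \<psi>) of
        (Some A, Some B) \<Rightarrow> if A ** B = B ** A then Some (A ** B) else None
      | _ \<Rightarrow> None)"
| "pba_val v (Or \<phi> \<psi>) =
     (case (pba_val v \<phi>, pba_val v \<psi>) of
        (Some A, Some B) \<Rightarrow> if A ** B = B ** A then Some (A + B - A ** B) else None
      | _ \<Rightarrow> None)"

definition sat_pba :: "('a::conjugatable_field ^ 'n) itself \<Rightarrow> fm \<Rightarrow> bool" where
  "sat_pba H \<phi> \<longleftrightarrow>
     (\<exists>v :: nat \<Rightarrow> 'a ^ 'n ^ 'n. (\<forall>i. ortho_projector (v i)) \<and>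
        (\<exists>A. pba_val v \<phi> = Some A \<and> A \<noteq> 0))"

definition distr_fm :: "nat \<Rightarrow> nat \<Rightarrow> nat \<Rightarrow> fm" where
  "distr_fm p q r =
     And (And (Atom p) (Or (Atom q) (Atom r)))
         (Neg (Or (And (Atom p) (Atom q)) (And (Atom p) (Atom r))))"

end

(* Subspace lattices are not distributive: for independent x and y, the line through x + y lies
   in the sum of the lines through x and y but meets each of them trivially, so the first conjunct
   is that line and the second the whole space. Where the formula has a PBA value, the projectors
   commute enough for distributivity to hold, and the value is X (1 - X) with X idempotent. *)
theory Submission
  imports Defs
begin

lemma matrix_add_rdistrib:
  fixes A B :: "'a::semiring_1 ^ 'n::finite ^ 'm" and C :: "'a ^ 'k ^ 'n"
  shows "(A + B) ** C = A ** C + B ** C"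
  by (simp add: matrix_matrix_mult_def vec_eq_iff distrib_right sum.distrib)

lemma matrix_diff_ldistrib:
  fixes A :: "'a::ring_1 ^ 'n::finite ^ 'm" and B C :: "'a ^ 'k ^ 'n"
  shows "A ** (B - C) = A ** B - A ** C"
  by (simp add: matrix_matrix_mult_def vec_eq_iff right_diff_distrib sum_subtractf)

lemma matrix_diff_rdistrib:
  fixes A B :: "'a::ring_1 ^ 'n::finite ^ 'm" and C :: "'a ^ 'k ^ 'n"
  shows "(A - B) ** C = A ** C - B ** C"
  by (simp add: matrix_matrix_mult_def vec_eq_iff left_diff_distrib sum_subtractf)

text \<open>Expanding the square, every mixed word in \<open>A\<close> and \<open>B\<close>
  collapses to \<open>A ** B\<close> by commutation and idempotence, and the surviving terms cancel.
  Applied below to the value of \<open>Or\<close>.\<close>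

lemma matrix_join_idem:
  fixes A B :: "'a::comm_ring_1 ^ 'n::finite ^ 'n"
  assumes A: "A ** A = A" and B: "B ** B = B" and AB: "A ** B = B ** A"
  shows "(A + B - A ** B) ** (A + B - A ** B) = A + B - A ** B"
proof -
  have 1: "A ** (A ** B) = A ** B" "B ** (A ** B) = A ** B"
    "A ** B ** A = A ** B" "A ** B ** B = A ** B" "A ** B ** (A ** B) = A ** B"
    using A B AB by (metis matrix_mul_assoc)+
  show ?thesis
    by (simp add: matrix_add_ldistrib matrix_add_rdistrib matrix_diff_ldistrib matrix_diff_rdistrib
        A B 1 AB[symmetric])
qed

lemma matrix_mult_idem:
  fixes A B :: "'a::comm_ring_1 ^ 'n::finite ^ 'n"
  assumes "A ** A = A" "B ** B = B" "A ** B = B ** A"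
  shows "A ** B ** (A ** B) = A ** B"
  using assms by (metis matrix_mul_assoc)

text \<open>The left side is the value of an \<open>Or\<close> of two meets with \<open>P\<close>.
  Moving the second \<open>P\<close> of the cross term past \<open>Q\<close> merges the two copies:
  PQPR = PPQR = PQR.\<close>

lemma matrix_mult_join_distrib:
  fixes P Q R :: "'a::comm_ring_1 ^ 'n::finite ^ 'n"
  assumes "P ** P = P" "P ** Q = Q ** P"
  shows "P ** Q + P ** R - P ** Q ** (P ** R) = P ** (Q + R - Q ** R)"
proof -
  have "P ** Q ** (P ** R) = P ** (Q ** R)"
    using assms by (metis matrix_mul_assoc)
  then show ?thesis
    by (simp add: matrix_add_ldistrib matrix_diff_ldistrib)
qed

lemma not_sat_pba_distr_fm:
  "\<not> sat_pba TYPE('a::conjugatable_field ^ 'n::finite) (distr_fm p q r)"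
proof
  assume "sat_pba TYPE('a ^ 'n) (distr_fm p q r)"
  then obtain v :: "nat \<Rightarrow> 'a ^ 'n ^ 'n" and A
    where v: "\<And>i. ortho_projector (v i)"
      and val: "pba_val v (distr_fm p q r) = Some A" and "A \<noteq> 0"
    unfolding sat_pba_def by blast
  define X where "X = v p ** (v q + v r - v q ** v r)"
  have idem: "v i ** v i = v i" for i
    using v by (simp add: ortho_projector_def)
  \<comment> \<open>A defined value means that every commutation test met in the recursion
    succeeded; these are the tests of \<open>p\<close> with \<open>q\<close>, of \<open>q\<close>
    with \<open>r\<close>, and of \<open>p\<close> with the join of \<open>q\<close> and
    \<open>r\<close>.\<close>
  have pq: "v p ** v q = v q ** v p"
    and qr: "v q ** v r = v r ** v q"
    and p_qr: "v p ** (v q + v r - v q ** v r) = (v q + v r - v q ** v r) ** v p"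
    and A: "A = X ** (mat 1 - (v p ** v q + v p ** v r - v p ** v q ** (v p ** v r)))"
    using val by (auto simp: distr_fm_def X_def split: if_splits)
  have "A = X ** (mat 1 - X)"
    unfolding A X_def matrix_mult_join_distrib[OF idem pq] ..
  \<comment> \<open>\<open>X\<close> is a product of two commuting idempotents, hence idempotent,
    and X - XX vanishes.\<close>
  also have "\<dots> = 0"
    using matrix_mult_idem[OF idem matrix_join_idem[OF idem idem qr] p_qr]
    by (simp add: X_def matrix_diff_ldistrib)
  finally show False using \<open>A \<noteq> 0\<close> by simp
qed

lemma sat_std_distr_fm:
  assumes "CARD('n::finite) \<ge> 2" and pqr: "distinct [p, q, r]"
  shows "sat_std TYPE('a::conjugatable_field ^ 'n) (distr_fm p q r)"
proof -
  obtain a b :: 'n where ab: "a \<noteq> b"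
    using assms(1) by (metis card_2_iff' ex_card)
  define x y :: "'a ^ 'n" where "x = axis a 1" and "y = axis b 1"
  \<comment> \<open>The final default branch gives the line through \<open>y\<close> to
    \<open>r\<close> and, harmlessly, to all remaining atoms, so that every value is a
    subspace.\<close>
  define v where "v i = vec.span (if i = p then {x + y} else if i = q then {x} else {y})" for i
  have v: "v p = range (\<lambda>k. k *s (x + y))" "v q = range (\<lambda>k. k *s x)" "v r = range (\<lambda>k. k *s y)"
    using pqr by (auto simp: v_def vec.span_singleton)
  have coords: "x $ a = 1" "x $ b = 0" "y $ a = 0" "y $ b = 1"
    using ab by (auto simp: x_def y_def axis_def)
  \<comment> \<open>Compare the coordinate in which the right side vanishes: \<open>b\<close> for
    multiples of \<open>x\<close>, \<open>a\<close> for multiples of \<open>y\<close>. There the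
    left side equals \<open>k\<close>.\<close>
  have coeff: "k = 0" if "k *s (x + y) = l *s x \<or> k *s (x + y) = l *s y" for k l
    using that
  proof
    assume "k *s (x + y) = l *s x"
    then have "(k *s (x + y)) $ b = (l *s x) $ b" by simp
    then show ?thesis by (simp add: coords)
  next
    assume "k *s (x + y) = l *s y"
    then have "(k *s (x + y)) $ a = (l *s y) $ a" by simp
    then show ?thesis by (simp add: coords)
  qed
  have "v p \<inter> (v q \<union> v r) \<subseteq> {0}"
  proof
    fix z assume "z \<in> v p \<inter> (v q \<union> v r)"
    then obtain k l where z: "z = k *s (x + y)" and "z = l *s x \<or> z = l *s y"
      unfolding v by blast
    then have "k = 0" by (intro coeff[of k l]) simp
    then show "z \<in> {0}" by (simp add: z)
  qed
  moreover have "0 \<in> v i" for i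
    by (simp add: v_def vec.span_zero)
  ultimately have "v p \<inter> v q = {0}" "v p \<inter> v r = {0}"
    by blast+
  moreover have "x + y \<in> v p"
    unfolding v by (metis rangeI vec.scale_one)
  moreover have "x + y \<in> v q + v r"
    unfolding v by (metis rangeI vec.scale_one set_plus_intro)
  \<comment> \<open>Both meets are {0}, so their sum is {0} and its complement is the whole space;
    only membership in the first conjunct remains.\<close>
  ultimately have "x + y \<in> std_val v (distr_fm p q r)"
    by (simp add: distr_fm_def ortho_compl_def hinner_def)
  moreover have "x + y \<noteq> 0"
    using coords by (metis add.right_neutral vector_add_component zero_index zero_neq_one)
  moreover have "vec.subspace (v i)" for i
    by (simp add: v_def)
  ultimately show ?thesis
    unfolding sat_std_def by blast
qed

theorem mainTheorem9:
  assumes "CARD('n::finite) \<ge> 2"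
  shows "((\<exists>\<phi>. sat_std TYPE(real ^ 'n) \<phi> \<and> \<not> sat_pba TYPE(real ^ 'n) \<phi>) \<and>
          (\<forall>p q r. distinct [p, q, r] \<longrightarrow>
             sat_std TYPE(real ^ 'n) (distr_fm p q r) \<and>
             \<not> sat_pba TYPE(real ^ 'n) (distr_fm p q r))) \<and>
         ((\<exists>\<phi>. sat_std TYPE(complex ^ 'n) \<phi> \<and> \<not> sat_pba TYPE(complex ^ 'n) \<phi>) \<and>
          (\<forall>p q r. distinct [p, q, r] \<longrightarrow>
             sat_std TYPE(complex ^ 'n) (distr_fm p q r) \<and>
             \<not> sat_pba TYPE(complex ^ 'n) (distr_fm p q r)))"
proof -
  \<comment> \<open>Stated for arbitrary predicates so that it serves both scalar fields; the
    existential part instantiates the atoms as 0, 1, 2.\<close>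
  have witness: "(\<exists>\<phi>. S \<phi> \<and> \<not> T \<phi>) \<and>
      (\<forall>p q r. distinct [p, q, r] \<longrightarrow> S (distr_fm p q r) \<and> \<not> T (distr_fm p q r))"
    if "\<And>p q r. distinct [p, q, r] \<Longrightarrow> S (distr_fm p q r)" "\<And>p q r. \<not> T (distr_fm p q r)"
    for S T
  proof -
    have "distinct [0, 1, 2 :: nat]" by simp
    with that show ?thesis by blast
  qed
  show ?thesis
    by (intro conjI[OF witness witness] sat_std_distr_fm[OF assms] not_sat_pba_distr_fm)
qed

end
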